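(* Let $Y$ be a simple graph on $n\geq 3$ vertices, and let $n_1,\dots,n_r$ denote the numbers of vertices of the connected components of the complement $\overline{Y}$. If $\gcd(n_1,\dots,n_r)=1$, then every connected component of $\mathsf{FS}(\mathsf{Cycle}_n,Y)$ has diameter at most $4n^3+|E(Y)|$.
   Context: For simple graphs $X,Y$ on $n$ vertices, $\mathsf{FS}(X,Y)$ has as vertices all bijections $V(X)\to V(Y)$, with $\sigma,\tau$ adjacent iff there is an edge $\{a,b\}\in E(X)$ such that $\{\sigma(a),\sigma(b)\}\in E(Y)$, $\tau(a)=\sigma(b)$, $\tau(b)=\sigma(a)$, and $\tau(c)=\sigma(c)$ for all other $c$. $\mathsf{Cycle}_n$ is the cycle on $[n]$ with edges $\{i,i+1\}$ for $i\in[n-1]$ and $\{n,1\}$. *)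

theory Defs
  imports "Graph_Theory.Graph_Theory" "HOL-Library.FuncSet"
begin

text \<open>
  Finite simple graphs are the symmetric loop-free digraphs without parallel arcs of
  \<^locale>\<open>pair_graph\<close>: an undirected edge $\{u,v\}$ is the pair of arcs $(u,v)$, $(v,u)$.
  Consequently the strongly connected components \<^const>\<open>pre_digraph.sccs\<close> of such a graph are
  its connected components (as induced subgraphs).
\<close>

text \<open>Undirected edges, so that each edge is counted once.\<close>

definition uedges :: "'a pair_pre_digraph \<Rightarrow> 'a set set" where
  "uedges G = {{u, v} | u v. (u, v) \<in> parcs G}"

definition complement_graph :: "'a pair_pre_digraph \<Rightarrow> 'a pair_pre_digraph" where
  "complement_graph G =
     \<lparr> pverts = pverts G,
       parcs = {(u, v). u \<in> pverts G \<and> v \<in> pverts G \<and> u \<noteq> v \<and> (u, v) \<notin> parcs G} \<rparr>"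

definition cycle_graph :: "nat \<Rightarrow> nat pair_pre_digraph" where
  "cycle_graph n =
     (let A = {(i, i + 1) | i. i \<in> {1..n - 1}} \<union> {(n, 1)}
      in \<lparr> pverts = {1..n}, parcs = A \<union> A\<inverse> \<rparr>)"

text \<open>
  Bijections $V(X) \to V(Y)$ are taken in the extensional function space, so that each of them
  is a single vertex of the friends-and-strangers graph.
\<close>

definition FS_graph ::
  "'a pair_pre_digraph \<Rightarrow> 'b pair_pre_digraph \<Rightarrow> ('a \<Rightarrow> 'b) pair_pre_digraph" where
  "FS_graph X Y =
     (let B = {\<sigma> \<in> pverts X \<rightarrow>\<^sub>E pverts Y. bij_betw \<sigma> (pverts X) (pverts Y)}
      in \<lparr> pverts = B,
           parcs = {(\<sigma>, \<tau>). \<sigma> \<in> B \<and> \<tau> \<in> B \<and>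
             (\<exists>a b. (a, b) \<in> parcs X \<and> (\<sigma> a, \<sigma> b) \<in> parcs Y \<and>
                    \<tau> a = \<sigma> b \<and> \<tau> b = \<sigma> a \<and>
                    (\<forall>c \<in> pverts X - {a, b}. \<tau> c = \<sigma> c))} \<rparr>)"

text \<open>
  With unit arc weights, \<^const>\<open>wf_digraph.\<mu>\<close> is the graph distance (the least number of arcs of
  a walk, and \<open>\<infinity>\<close> if there is no walk).
\<close>

definition graph_diameter :: "('a, 'b) pre_digraph \<Rightarrow> ereal" where
  "graph_diameter G = (SUP u \<in> verts G. SUP v \<in> verts G. wf_digraph.\<mu> G (\<lambda>_. 1) u v)"

lemma pair_graph_complement_graph:
  assumes "pair_graph G"
  shows "pair_graph (complement_graph G)"
proof -
  interpret pair_graph G by fact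
  have "finite (parcs (complement_graph G))"
    by (rule finite_subset[of _ "pverts G \<times> pverts G"])
       (auto simp: complement_graph_def pair_finite_verts)
  then show ?thesis
    using pair_sym_arcs pair_finite_verts
    by unfold_locales (auto simp: complement_graph_def symmetric_def sym_def)
qed

lemma pair_graph_cycle_graph:
  assumes "n \<ge> 3"
  shows "pair_graph (cycle_graph n)"
proof -
  have "finite (parcs (cycle_graph n))"
    by (rule finite_subset[of _ "{1..n} \<times> {1..n}"])
       (use assms in \<open>auto simp: cycle_graph_def Let_def\<close>)
  then show ?thesis
    using assms
    by unfold_locales (auto simp: cycle_graph_def Let_def symmetric_def sym_def)
qed

lemma pair_graph_FS_graph:
  assumes "pair_graph X" "pair_graph Y"
  shows "pair_graph (FS_graph X Y)"
proof -
  interpret X: pair_graph X by fact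
  interpret Y: pair_graph Y by fact
  have fin: "finite (pverts (FS_graph X Y))"
    by (rule finite_subset[of _ "pverts X \<rightarrow>\<^sub>E pverts Y"])
       (auto simp: FS_graph_def Let_def X.pair_finite_verts Y.pair_finite_verts finite_PiE)
  have sub: "parcs (FS_graph X Y) \<subseteq> pverts (FS_graph X Y) \<times> pverts (FS_graph X Y)"
    by (auto simp: FS_graph_def Let_def)
  have symY: "(v, u) \<in> parcs Y" if "(u, v) \<in> parcs Y" for u v
    using Y.pair_sym_arcs that by (auto simp: symmetric_def sym_def)
  have arc_iff: "(\<sigma>, \<tau>) \<in> parcs (FS_graph X Y) \<longleftrightarrow>
      \<sigma> \<in> pverts (FS_graph X Y) \<and> \<tau> \<in> pverts (FS_graph X Y) \<and>
      (\<exists>a b. (a, b) \<in> parcs X \<and> (\<sigma> a, \<sigma> b) \<in> parcs Y \<and> \<tau> a = \<sigma> b \<and> \<tau> b = \<sigma> a \<and>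
             (\<forall>c \<in> pverts X - {a, b}. \<tau> c = \<sigma> c))" for \<sigma> \<tau>
    by (simp add: FS_graph_def Let_def)
  have "(\<tau>, \<sigma>) \<in> parcs (FS_graph X Y)" if st: "(\<sigma>, \<tau>) \<in> parcs (FS_graph X Y)" for \<sigma> \<tau>
  proof -
    obtain a b where "(a, b) \<in> parcs X" "(\<sigma> a, \<sigma> b) \<in> parcs Y" "\<tau> a = \<sigma> b" "\<tau> b = \<sigma> a"
      "\<forall>c \<in> pverts X - {a, b}. \<tau> c = \<sigma> c"
      using st[unfolded arc_iff] by blast
    then have "(a, b) \<in> parcs X \<and> (\<tau> a, \<tau> b) \<in> parcs Y \<and> \<sigma> a = \<tau> b \<and> \<sigma> b = \<tau> a \<and>
        (\<forall>c \<in> pverts X - {a, b}. \<sigma> c = \<tau> c)"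
      using symY by simp
    then show ?thesis
      using st unfolding arc_iff by blast
  qed
  then have sym: "symmetric (FS_graph X Y)"
    by (auto simp: symmetric_def sym_def)
  have loop: "\<sigma> \<noteq> \<tau>" if st: "(\<sigma>, \<tau>) \<in> parcs (FS_graph X Y)" for \<sigma> \<tau>
  proof -
    obtain a b where "(\<sigma> a, \<sigma> b) \<in> parcs Y" "\<tau> a = \<sigma> b"
      using st[unfolded arc_iff] by blast
    then show ?thesis
      using Y.pair_no_loops by fastforce
  qed
  show ?thesis
    using fin sub sym loop finite_subset[OF sub]
    by unfold_locales auto
qed

end

theory Submission
  imports Defs "HOL-Combinatorics.Permutations"
begin

text \<open>
  Lift an arrangement on the cycle to the universal cover \<open>\<int>\<close>, giving each person \<open>v\<close> a position
  \<open>p v \<in> \<int>\<close>. A swap moves one person by \<open>+1\<close> and a friend by \<open>-1\<close>; it preserves \<open>\<Sum>v. p v\<close> and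
  the winding \<open>\<lfloor>(p x - p y) / n\<rfloor>\<close> of every pair of non-friends. Conversely, as for the length
  function of the affine symmetric group, two lifts that agree in these invariants are joined by a
  walk whose length is the total difference of the windings over all pairs of friends.

  The lift of the target may be altered by turning whole components of the complement around the
  cycle, as long as \<open>\<Sum>v. p v\<close> is kept. Among all such lifts choose one that minimises the sum of the
  squared displacements. Within a component of the complement displacements differ by at most
  \<open>n\<^sup>2\<close>, and minimality prevents those of different components from being more than
  \<open>8 n\<^sup>2\<close> apart. Hence each winding changes by at most \<open>8 n\<close>, which gives a walk of
  length at most \<open>4 n\<^sup>3\<close>.
\<close>

section \<open>Slots, windings and swaps in integer arithmetic\<close>

text \<open>The position in \<open>{1..n}\<close> on the cycle that lies below \<open>z \<in> \<int>\<close>.\<close>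

definition slot :: "nat \<Rightarrow> int \<Rightarrow> nat" where
  "slot n z = nat ((z - 1) mod int n) + 1"

text \<open>The number of full turns, rounded down, by which \<open>x\<close> is ahead of
  \<open>y\<close>; it changes only when the gap crosses a multiple of \<open>n\<close>, that is,
  when \<open>x\<close> passes a copy of \<open>y\<close>.\<close>

definition winding :: "nat \<Rightarrow> ('a \<Rightarrow> int) \<Rightarrow> 'a \<Rightarrow> 'a \<Rightarrow> int" where
  "winding n p x y = (p x - p y) div int n"

text \<open>The integers \<open>p u\<close> and \<open>p v\<close> need not be adjacent: this models
  a swap on the cycle whenever \<open>v\<close> stands right after \<open>u\<close> modulo
  \<open>n\<close>.\<close>

definition swap_lift :: "('a \<Rightarrow> int) \<Rightarrow> 'a \<Rightarrow> 'a \<Rightarrow> 'a \<Rightarrow> int" where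
  "swap_lift p u v = p(u := p u + 1, v := p v - 1)"

lemma slot_eq_iff:
  assumes "n > 0"
  shows "slot n y = slot n z \<longleftrightarrow> int n dvd y - z"
proof -
  have "slot n y = slot n z \<longleftrightarrow> (y - 1) mod int n = (z - 1) mod int n"
    using assms by (simp add: slot_def eq_nat_nat_iff)
  then show ?thesis
    by (simp add: mod_eq_dvd_iff)
qed

lemma slot_in: "n > 0 \<Longrightarrow> slot n z \<in> {1..n}"
  using pos_mod_bound[of "int n" "z - 1"] by (simp add: slot_def Suc_le_eq nat_less_iff)

lemma slot_int: "i \<in> {1..n} \<Longrightarrow> slot n (int i) = i"
  by (auto simp: slot_def)

text \<open>Congruences spare a separate treatment of the wrap-around edge on the universal
  cover.\<close>

lemma cycle_graph_arcs_iff: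
  assumes "n \<ge> 3"
  shows "(a, b) \<in> parcs (cycle_graph n) \<longleftrightarrow>
    a \<in> {1..n} \<and> b \<in> {1..n} \<and> (int n dvd int b - int a - 1 \<or> int n dvd int a - int b - 1)"
proof -
  have *: "int n dvd int b - int a - 1 \<longleftrightarrow> b = a + 1 \<or> a = n \<and> b = 1"
    if "a \<in> {1..n}" "b \<in> {1..n}" for a b
  proof
    assume "int n dvd int b - int a - 1"
    then obtain k where k: "int b - int a - 1 = int n * k" by (rule dvdE)
    \<comment> \<open>The value lies between \<open>- n\<close> and \<open>n - 2\<close>, so
      \<open>k\<close> is 0 or -1; the latter is the wrap-around edge.\<close>
    have "int n * k < int n * 1" "int n * (- 2) < int n * k"
      using that assms by (auto simp flip: k)
    then have "k < 1" "- 2 < k"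
      using assms by (auto simp only: mult_less_cancel_left)
    then have "k = 0 \<or> k = - 1" by auto
    then show "b = a + 1 \<or> a = n \<and> b = 1"
      using k that by auto
  qed (use that in auto)
  show ?thesis
  proof (cases "a \<in> {1..n} \<and> b \<in> {1..n}")
    case True
    then show ?thesis
      using *[of a b] *[of b a] by (auto simp: cycle_graph_def Let_def)
  qed (use assms in \<open>auto simp: cycle_graph_def Let_def\<close>)
qed

lemma div_add_one_if:
  fixes a m :: int
  assumes "m > 0"
  shows "(a + 1) div m = a div m + (if m dvd a + 1 then 1 else 0)"
proof (cases "m dvd a + 1")
  case True
  then obtain k where k: "a + 1 = m * k" by (rule dvdE)
  then have "a = m * (k - 1) + (m - 1)" by (simp add: algebra_simps)
  then have "a div m = k - 1" using assms by (intro int_div_pos_eq[of a m _ "m - 1"]) auto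
  then show ?thesis using True k assms by simp
next
  case False
  then have "(a + 1) mod m \<noteq> 0" by (simp add: dvd_eq_mod_eq_0)
  moreover have "a = m * ((a + 1) div m) + ((a + 1) mod m - 1)"
    using mult_div_mod_eq[of m "a + 1"] by linarith
  ultimately have "a div m = (a + 1) div m"
    using pos_mod_bound[OF assms, of "a + 1"] pos_mod_sign[OF assms, of "a + 1"]
    by (intro int_div_pos_eq[of a m _ "(a + 1) mod m - 1"]) linarith+
  then show ?thesis using False by simp
qed

lemma div_diff_one_if:
  fixes a m :: int
  assumes "m > 0"
  shows "(a - 1) div m = a div m - (if m dvd a then 1 else 0)"
  using div_add_one_if[OF assms, of "a - 1"] by simp

text \<open>A unit step changes a rounded quotient only at a multiple of \<open>n\<close>. Against a
  third person this cannot happen, since \<open>u\<close> and \<open>v\<close> merely exchange their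
  residues and nobody else has either of them. Only the gap between \<open>u\<close> and
  \<open>v\<close> crosses a multiple.\<close>

lemma winding_swap_lift:
  assumes n: "n \<ge> 2" and inj: "\<And>x y. x \<in> V \<Longrightarrow> y \<in> V \<Longrightarrow> int n dvd p x - p y \<Longrightarrow> x = y"
    and uv: "u \<in> V" "v \<in> V" "int n dvd p v - p u - 1" and xy: "x \<in> V" "y \<in> V" "x \<noteq> y"
  shows "winding n (swap_lift p u v) x y =
    winding n p x y + (if x = u \<and> y = v then 1 else if x = v \<and> y = u then - 1 else 0)"
proof -
  define N where "N = int n"
  have N: "N > 0" "N \<ge> 2" using n by (auto simp: N_def)
  note plus = div_add_one_if[OF N(1)] and minus = div_diff_one_if[OF N(1)]
  have n1: "\<not> N dvd 1" using N by auto
  have uv': "N dvd p v - p u - 1" using uv by (simp add: N_def)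
  have ne: "u \<noteq> v"
    using uv' n1 by (metis diff_self diff_0 dvd_minus_iff)
  have ndvd: "\<not> N dvd p a - p b" if "a \<in> V" "b \<in> V" "a \<noteq> b" for a b
    using inj that by (auto simp: N_def)
  have vu: "N dvd p u - p v + 1"
    using uv' dvd_minus_iff[of N "p v - p u - 1"] by (simp add: algebra_simps)
  have to_v: "N dvd p u - p y + 1 \<longleftrightarrow> N dvd p v - p y" for y
    using dvd_add_left_iff[OF uv', of "p u - p y + 1"] by (simp add: algebra_simps)
  have to_u: "N dvd p y - p v + 1 \<longleftrightarrow> N dvd p y - p u" for y
    using dvd_add_left_iff[OF uv', of "p y - p v + 1"] by (simp add: algebra_simps)
  define s where "s = swap_lift p u v"
  have s: "s u = p u + 1" "s v = p v - 1" "\<And>w. w \<noteq> u \<Longrightarrow> w \<noteq> v \<Longrightarrow> s w = p w"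
    using ne by (simp_all add: s_def swap_lift_def)
  consider "x = u" "y = v" | "x = v" "y = u" | "x = u" "y \<noteq> u" "y \<noteq> v" | "x = v" "y \<noteq> u" "y \<noteq> v"
    | "y = u" "x \<noteq> u" "x \<noteq> v" | "y = v" "x \<noteq> u" "x \<noteq> v" | "x \<noteq> u" "x \<noteq> v" "y \<noteq> u" "y \<noteq> v"
    using xy by (cases "x = u"; cases "x = v"; cases "y = u"; cases "y = v") auto
  then have "(s x - s y) div N =
    (p x - p y) div N + (if x = u \<and> y = v then 1 else if x = v \<and> y = u then - 1 else 0)"
  proof cases
    case 1
    have a: "s x - s y = p u - p v + 1 + 1"
      using 1 by (simp add: s)
    \<comment> \<open>Of the two unit steps, only the first one reaches a multiple of
      \<open>N\<close>.\<close>
    have b: "(p u - p v + 1 + 1) div N = (p u - p v) div N + 1"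
      using n1 vu dvd_add_right_iff[OF vu, of 1] plus[of "p u - p v + 1"] plus[of "p u - p v"] by simp
    show ?thesis
      unfolding a b using 1 ne by simp
  next
    case 2
    have a: "s x - s y = p v - p u - 1 - 1"
      using 2 by (simp add: s)
    have b: "(p v - p u - 1 - 1) div N = (p v - p u) div N - 1"
      using uv' ndvd[of v u] uv ne minus[of "p v - p u - 1"] minus[of "p v - p u"] by simp
    show ?thesis
      unfolding a b using 2 ne by simp
  next
    case 3
    have a: "s x - s y = p u - p y + 1"
      using 3 by (simp add: s)
    have b: "(p u - p y + 1) div N = (p u - p y) div N"
      using plus[of "p u - p y"] to_v[of y] ndvd[of v y] 3 uv xy by simp
    show ?thesis
      unfolding a b using 3 ne by simp
  next
    case 4
    have a: "s x - s y = p v - p y - 1"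
      using 4 by (simp add: s)
    have b: "(p v - p y - 1) div N = (p v - p y) div N"
      using minus[of "p v - p y"] ndvd[of v y] 4 uv xy by simp
    show ?thesis
      unfolding a b using 4 ne by simp
  next
    case 5
    have a: "s x - s y = p x - p u - 1"
      using 5 by (simp add: s)
    have b: "(p x - p u - 1) div N = (p x - p u) div N"
      using minus[of "p x - p u"] ndvd[of x u] 5 uv xy by simp
    show ?thesis
      unfolding a b using 5 ne by simp
  next
    case 6
    have a: "s x - s y = p x - p v + 1"
      using 6 by (simp add: s)
    have b: "(p x - p v + 1) div N = (p x - p v) div N"
      using plus[of "p x - p v"] to_u[of x] ndvd[of x u] 6 uv xy by simp
    show ?thesis
      unfolding a b using 6 ne by simp
  next
    case 7
    then show ?thesis by (simp add: s)
  qed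
  then show ?thesis
    by (simp add: winding_def s_def N_def)
qed

text \<open>The remainders perturb the difference of the quotients by less than one, and that
  difference is an integer.\<close>

lemma winding_diff_bound:
  assumes "n > 0" "\<bar>(q x - p x) - (q y - p y)\<bar> \<le> int n * K"
  shows "\<bar>winding n q x y - winding n p x y\<bar> \<le> K"
proof -
  define N a b where "N = int n" and "a = p x - p y" and "b = q x - q y"
  have N: "N > 0" using assms by (simp add: N_def)
  have "N * (a div N) + a mod N = a" "N * (b div N) + b mod N = b"
    by (simp_all add: mult_div_mod_eq)
  moreover have "0 \<le> a mod N" "a mod N < N" "0 \<le> b mod N" "b mod N < N"
    using N by simp_all
  moreover have "\<bar>b - a\<bar> \<le> N * K" using assms(2) by (simp add: N_def a_def b_def algebra_simps)
  ultimately have "N * (b div N) < N * (a div N) + N * K + N" "N * (a div N) < N * (b div N) + N * K + N"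
    by linarith+
  then have "N * (b div N - a div N) < N * (K + 1)" "N * (a div N - b div N) < N * (K + 1)"
    by (simp_all add: algebra_simps)
  then have "b div N - a div N < K + 1" "a div N - b div N < K + 1"
    using N by (auto simp only: mult_less_cancel_left_pos)
  then show ?thesis by (simp add: winding_def N_def a_def b_def)
qed

text \<open>With equal quotients, the displacements differ by the difference of two remainders
  modulo \<open>n\<close>.\<close>

lemma displacement_diff_less:
  assumes "n > 0" "winding n q x y = winding n p x y"
  shows "\<bar>(q x - p x) - (q y - p y)\<bar> < int n"
proof -
  define N a b where "N = int n" and "a = p x - p y" and "b = q x - q y"
  have N: "N > 0" using assms by (simp add: N_def)
  have "N * (a div N) + a mod N = a" "N * (b div N) + b mod N = b"
    by (simp_all add: mult_div_mod_eq)
  moreover have "0 \<le> a mod N" "a mod N < N" "0 \<le> b mod N" "b mod N < N"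
    using N by simp_all
  moreover have "N * (a div N) = N * (b div N)" using assms(2) by (simp add: winding_def N_def a_def b_def)
  ultimately have "\<bar>b - a\<bar> < N" by linarith
  then show ?thesis by (simp add: N_def a_def b_def algebra_simps)
qed

section \<open>Walks within a connected component\<close>

text \<open>Reachability is symmetric, so by maximality of \<open>H\<close> a walk that starts in
  \<open>H\<close> never leaves it, and \<open>H\<close>, being induced, has all of its arcs. Thus
  walks of the whole graph can bound distances inside a component.\<close>

lemma (in sym_digraph) awalk_in_scc:
  assumes H: "H \<in> sccs" and "awalk u p v" and "u \<in> verts H"
  shows "pre_digraph.awalk H u p v"
proof -
  have ind: "induced_subgraph H G" using H by (rule in_sccs_imp_induced)
  then have sub: "subgraph H G" by (simp add: induced_subgraph_def)
  interpret H: wf_digraph H using sub by (rule subgraphE)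
  have sv: "verts H \<in> sccs_verts"
    using H by (intro in_sccs_vertsI_sccs imageI)
  then have max: "w \<in> verts H" if "x \<in> verts H" "x \<rightarrow>\<^sup>* w" "w \<rightarrow>\<^sup>* x" for x w
    using that unfolding in_sccs_verts_conv_reachable by metis
  have ht: "head H = head G" "tail H = tail G"
    using sub by (auto simp: subgraph_def compatible_def)
  show ?thesis
    using assms(2,3)
  proof (induction p arbitrary: u)
    case Nil
    then show ?case by (simp add: awalk_Nil_iff H.awalk_Nil_iff)
  next
    case (Cons e es)
    have e: "e \<in> arcs G" "u = tail G e" "awalk (head G e) es v"
      using Cons.prems(1) by (simp_all add: awalk_Cons_iff)
    have "u \<rightarrow>\<^sup>* head G e"
      using in_arcs_imp_in_arcs_ends[OF e(1)] e(2) by simp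
    with max[OF Cons.prems(2)] have h: "head G e \<in> verts H"
      using symmetric_reachable' by blast
    have "e \<in> arcs H"
      using ind e(1,2) h Cons.prems(2) by (simp add: induced_subgraph_def)
    then show ?case
      using Cons.IH[OF e(3) h] e(2) ht by (simp add: H.awalk_Cons_iff)
  qed
qed

section \<open>The friends-and-strangers graph over the cycle\<close>

locale cycle_FS = pair_graph Y for Y :: "'a pair_pre_digraph" +
  fixes n :: nat
  assumes card_verts: "card (pverts Y) = n"
    and n_ge_3: "n \<ge> 3"
begin

abbreviation "FS \<equiv> FS_graph (cycle_graph n) Y"
abbreviation "Yc \<equiv> complement_graph Y"

sublocale FS: pair_graph FS
  by (intro pair_graph_FS_graph pair_graph_cycle_graph n_ge_3 pair_graph_axioms)

sublocale Yc: pair_graph Yc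
  by (intro pair_graph_complement_graph pair_graph_axioms)

lemma n_pos: "n > 0"
  using n_ge_3 by simp

lemma Yc_arcs_iff: "(x, y) \<in> parcs Yc \<longleftrightarrow> x \<in> pverts Y \<and> y \<in> pverts Y \<and> x \<noteq> y \<and> (x, y) \<notin> parcs Y"
  by (simp add: complement_graph_def)

lemma verts_Yc [simp]: "pverts Yc = pverts Y"
  by (simp add: complement_graph_def)

lemma arcs_sym: "(u, v) \<in> parcs Y \<Longrightarrow> (v, u) \<in> parcs Y"
  using pair_sym_arcs by (auto simp: symmetric_def sym_def)

lemma arc_verts: "(u, v) \<in> parcs Y \<Longrightarrow> u \<in> pverts Y \<and> v \<in> pverts Y \<and> u \<noteq> v"
  using in_arcsD1 in_arcsD2 pair_no_loops by fastforce

lemma verts_FS_iff: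
  "\<sigma> \<in> pverts FS \<longleftrightarrow> \<sigma> \<in> {1..n} \<rightarrow>\<^sub>E pverts Y \<and> bij_betw \<sigma> {1..n} (pverts Y)"
  by (simp add: FS_graph_def cycle_graph_def Let_def)

lemma arcs_FS_iff:
  "(\<sigma>, \<tau>) \<in> parcs FS \<longleftrightarrow> \<sigma> \<in> pverts FS \<and> \<tau> \<in> pverts FS \<and>
    (\<exists>a b. (a, b) \<in> parcs (cycle_graph n) \<and> (\<sigma> a, \<sigma> b) \<in> parcs Y \<and> \<tau> a = \<sigma> b \<and> \<tau> b = \<sigma> a \<and>
      (\<forall>c \<in> {1..n} - {a, b}. \<tau> c = \<sigma> c))"
  unfolding FS_graph_def Let_def by (simp add: cycle_graph_def Let_def)

section \<open>Lifts and their invariants\<close>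

text \<open>
  A lift places the people on the universal cover \<open>\<int>\<close> of the cycle; \<open>n\<close>-periodicity is implicit.
\<close>

definition is_lift :: "('a \<Rightarrow> int) \<Rightarrow> (nat \<Rightarrow> 'a) \<Rightarrow> bool" where
  "is_lift p \<sigma> \<longleftrightarrow> \<sigma> \<in> pverts FS \<and> (\<forall>v \<in> pverts Y. \<sigma> (slot n (p v)) = v)"

text \<open>Equal windings alone would also allow a common translation of all people; the sum
  excludes it.\<close>

definition homotopic :: "('a \<Rightarrow> int) \<Rightarrow> ('a \<Rightarrow> int) \<Rightarrow> bool" where
  "homotopic p q \<longleftrightarrow> sum p (pverts Y) = sum q (pverts Y) \<and>
    (\<forall>(x, y) \<in> parcs Yc. winding n p x y = winding n q x y)"

lemma homotopic_refl: "homotopic p p"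
  by (auto simp: homotopic_def)

lemma homotopic_trans: "homotopic p q \<Longrightarrow> homotopic q r \<Longrightarrow> homotopic p r"
  unfolding homotopic_def by fastforce

lemma homotopic_sym: "homotopic p q \<Longrightarrow> homotopic q p"
  unfolding homotopic_def by fastforce

lemma lift_exists:
  assumes "\<sigma> \<in> pverts FS"
  shows "\<exists>p. is_lift p \<sigma>"
proof
  have bij: "bij_betw \<sigma> {1..n} (pverts Y)" using assms by (simp add: verts_FS_iff)
  have "\<sigma> (slot n (int (inv_into {1..n} \<sigma> v))) = v" if "v \<in> pverts Y" for v
    using bij_betw_inv_into_right[OF bij that] slot_int
      bij_betwE[OF bij_betw_inv_into[OF bij]] that by metis
  then show "is_lift (\<lambda>v. int (inv_into {1..n} \<sigma> v)) \<sigma>"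
    using assms by (simp add: is_lift_def)
qed

lemma lift_inj:
  assumes "is_lift p \<sigma>" "x \<in> pverts Y" "y \<in> pverts Y" "int n dvd p x - p y"
  shows "x = y"
  using assms slot_eq_iff[OF n_pos, of "p x" "p y"] unfolding is_lift_def by metis

lemma lift_surj:
  assumes "is_lift p \<sigma>"
  shows "\<exists>v \<in> pverts Y. int n dvd p v - z"
proof
  have \<sigma>: "inj_on \<sigma> {1..n}" "\<sigma> ` {1..n} = pverts Y"
    using assms by (auto simp: is_lift_def verts_FS_iff bij_betw_def)
  show v: "\<sigma> (slot n z) \<in> pverts Y"
    using \<sigma>(2) slot_in[OF n_pos, of z] by blast
  have "\<sigma> (slot n (p (\<sigma> (slot n z)))) = \<sigma> (slot n z)"
    using assms v by (simp add: is_lift_def)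
  then have "slot n (p (\<sigma> (slot n z))) = slot n z"
    using \<sigma>(1) slot_in[OF n_pos] by (auto dest: inj_onD)
  then show "int n dvd p (\<sigma> (slot n z)) - z"
    using slot_eq_iff[OF n_pos] by blast
qed

lemma lift_unique:
  assumes "is_lift p \<sigma>" "is_lift p \<tau>"
  shows "\<sigma> = \<tau>"
proof (rule PiE_ext)
  show "\<sigma> \<in> {1..n} \<rightarrow>\<^sub>E pverts Y" "\<tau> \<in> {1..n} \<rightarrow>\<^sub>E pverts Y"
    using assms by (auto simp: is_lift_def verts_FS_iff)
  fix i assume i: "i \<in> {1..n}"
  obtain v where v: "v \<in> pverts Y" "int n dvd p v - int i"
    using lift_surj[OF assms(1)] by blast
  then have "slot n (p v) = i"
    using slot_eq_iff[OF n_pos] slot_int[OF i] by metis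
  then show "\<sigma> i = \<tau> i"
    using assms v(1) unfolding is_lift_def by metis
qed

text \<open>Only residues modulo \<open>n\<close> matter, so full turns of single persons leave the
  arrangement on the cycle unchanged.\<close>

lemma is_lift_cong:
  assumes "is_lift p \<sigma>" "\<And>v. v \<in> pverts Y \<Longrightarrow> int n dvd q v - p v"
  shows "is_lift q \<sigma>"
  using assms slot_eq_iff[OF n_pos] unfolding is_lift_def by metis

section \<open>Arcs as unit exchanges on the universal cover\<close>

lemma dvd_succ_neq: "int n dvd p v - p u - 1 \<Longrightarrow> u \<noteq> v"
  using n_ge_3 by auto

lemma is_lift_swap:
  assumes p: "is_lift p \<sigma>" and \<tau>: "\<tau> \<in> pverts FS" and uv: "u \<in> pverts Y" "v \<in> pverts Y"
    and adj: "int n dvd p v - p u - 1"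
    and sw: "\<tau> (slot n (p u)) = v" "\<tau> (slot n (p v)) = u"
      "\<And>c. c \<in> {1..n} - {slot n (p u), slot n (p v)} \<Longrightarrow> \<tau> c = \<sigma> c"
  shows "is_lift (swap_lift p u v) \<tau>"
  unfolding is_lift_def
proof (intro conjI ballI \<tau>)
  fix w assume w: "w \<in> pverts Y"
  have ne: "u \<noteq> v" using adj by (rule dvd_succ_neq)
  have "int n dvd p u + 1 - p v"
    using adj dvd_minus_iff[of "int n" "p v - p u - 1"] by (simp add: algebra_simps)
  then have su: "slot n (p u + 1) = slot n (p v)"
    by (simp add: slot_eq_iff[OF n_pos])
  have sv: "slot n (p v - 1) = slot n (p u)"
    using adj by (simp add: slot_eq_iff[OF n_pos] algebra_simps)
  have sl: "\<sigma> (slot n (p x)) = x" if "x \<in> pverts Y" for x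
    using p that by (simp add: is_lift_def)
  consider "w = u" | "w = v" | "w \<noteq> u" "w \<noteq> v" by blast
  then show "\<tau> (slot n (swap_lift p u v w)) = w"
  proof cases
    case 3
    then have "slot n (p w) \<in> {1..n} - {slot n (p u), slot n (p v)}"
      using slot_in[OF n_pos] sl uv w by (metis DiffI insertE singletonD)
    then show ?thesis using 3 sw(3) sl[OF w] by (simp add: swap_lift_def)
  qed (use sw su sv ne in \<open>auto simp: swap_lift_def\<close>)
qed

text \<open>The person at the first end of the cycle edge steps forward and the one at its successor
  steps backward; the two orientations of the edge are symmetric.\<close>

lemma arc_lift:
  assumes p: "is_lift p \<sigma>" and arc: "(\<sigma>, \<tau>) \<in> parcs FS"
  shows "\<exists>u v. (u, v) \<in> parcs Y \<and> int n dvd p v - p u - 1 \<and> is_lift (swap_lift p u v) \<tau>"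
proof -
  have *: ?thesis
    if ab: "a \<in> {1..n}" "b \<in> {1..n}" "int n dvd int b - int a - 1" "(\<sigma> a, \<sigma> b) \<in> parcs Y"
      "\<tau> a = \<sigma> b" "\<tau> b = \<sigma> a" "\<And>c. c \<in> {1..n} - {a, b} \<Longrightarrow> \<tau> c = \<sigma> c" for a b
  proof (intro exI conjI)
    show "(\<sigma> a, \<sigma> b) \<in> parcs Y" by fact
    then have V: "\<sigma> a \<in> pverts Y" "\<sigma> b \<in> pverts Y" using arc_verts by blast+
    have \<sigma>: "inj_on \<sigma> {1..n}"
      using p by (auto simp: is_lift_def verts_FS_iff bij_betw_def)
    have sl: "slot n (p (\<sigma> i)) = i" if "i \<in> {1..n}" "\<sigma> i \<in> pverts Y" for i
      using p that slot_in[OF n_pos] inj_onD[OF \<sigma>] unfolding is_lift_def by metis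
    have d: "int n dvd p (\<sigma> i) - int i" if "i \<in> {1..n}" "\<sigma> i \<in> pverts Y" for i
      using sl[OF that] slot_int[OF that(1)] slot_eq_iff[OF n_pos] by metis
    show adj: "int n dvd p (\<sigma> b) - p (\<sigma> a) - 1"
    proof -
      have "p (\<sigma> b) - p (\<sigma> a) - 1 = (p (\<sigma> b) - int b) - (p (\<sigma> a) - int a) + (int b - int a - 1)"
        by linarith
      then show ?thesis
        using dvd_add[OF dvd_diff[OF d[OF ab(2) V(2)] d[OF ab(1) V(1)]] ab(3)] by (rule ssubst)
    qed
    show "is_lift (swap_lift p (\<sigma> a) (\<sigma> b)) \<tau>"
    proof (rule is_lift_swap[OF p _ V adj])
      show "\<tau> \<in> pverts FS" using arc by (simp add: arcs_FS_iff)
      show "\<tau> (slot n (p (\<sigma> a))) = \<sigma> b" "\<tau> (slot n (p (\<sigma> b))) = \<sigma> a"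
        using ab(5,6) sl[OF ab(1) V(1)] sl[OF ab(2) V(2)] by simp_all
      show "\<tau> c = \<sigma> c" if "c \<in> {1..n} - {slot n (p (\<sigma> a)), slot n (p (\<sigma> b))}" for c
        using that ab(7) sl[OF ab(1) V(1)] sl[OF ab(2) V(2)] by simp
    qed
  qed
  obtain a b where ab: "(a, b) \<in> parcs (cycle_graph n)" "(\<sigma> a, \<sigma> b) \<in> parcs Y" "\<tau> a = \<sigma> b" "\<tau> b = \<sigma> a"
    "\<And>c. c \<in> {1..n} - {a, b} \<Longrightarrow> \<tau> c = \<sigma> c"
    using arc unfolding arcs_FS_iff by blast
  then have in_n: "a \<in> {1..n}" "b \<in> {1..n}"
    and "int n dvd int b - int a - 1 \<or> int n dvd int a - int b - 1"
    using cycle_graph_arcs_iff[OF n_ge_3] by blast+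
  from this(3) show ?thesis
  proof
    assume "int n dvd int b - int a - 1"
    from *[OF in_n(1,2) this ab(2-5)] show ?thesis .
  next
    assume "int n dvd int a - int b - 1"
    from *[OF in_n(2,1) this arcs_sym[OF ab(2)] ab(4,3)] ab(5) show ?thesis
      by (simp only: insert_commute)
  qed
qed

text \<open>Converse of \<open>arc_lift\<close>: on the cycle, the exchange composes
  \<open>\<sigma>\<close> with the transposition of the slots of \<open>u\<close> and
  \<open>v\<close>.\<close>

lemma lift_arc:
  assumes p: "is_lift p \<sigma>" and uv: "(u, v) \<in> parcs Y" and adj: "int n dvd p v - p u - 1"
  shows "\<exists>\<tau>. (\<sigma>, \<tau>) \<in> parcs FS \<and> is_lift (swap_lift p u v) \<tau>"
proof -
  define a b where "a = slot n (p u)" and "b = slot n (p v)"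
  define \<tau> where "\<tau> = \<sigma>(a := v, b := u)"
  have V: "u \<in> pverts Y" "v \<in> pverts Y" using arc_verts[OF uv] by auto
  have ne: "u \<noteq> v" using adj by (rule dvd_succ_neq)
  have ab: "a \<in> {1..n}" "b \<in> {1..n}"
    using slot_in[OF n_pos] by (auto simp: a_def b_def)
  have \<sigma>ab: "\<sigma> a = u" "\<sigma> b = v"
    using p V by (auto simp: is_lift_def a_def b_def)
  then have nab: "a \<noteq> b" using ne by auto
  have "\<tau> = \<sigma> \<circ> Transposition.transpose a b"
    using \<sigma>ab by (auto simp: \<tau>_def fun_eq_iff Transposition.transpose_def)
  moreover have "bij_betw (Transposition.transpose a b) {1..n} {1..n}"
    using ab by (intro permutes_imp_bij permutes_swap_id)
  ultimately have "bij_betw \<tau> {1..n} (pverts Y)"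
    using p by (auto simp: is_lift_def verts_FS_iff intro: bij_betw_trans)
  moreover have "\<tau> \<in> {1..n} \<rightarrow>\<^sub>E pverts Y"
    using p V ab by (auto simp: is_lift_def verts_FS_iff \<tau>_def PiE_iff extensional_def)
  ultimately have \<tau>V: "\<tau> \<in> pverts FS"
    by (simp add: verts_FS_iff)
  have \<tau>: "\<tau> a = v" "\<tau> b = u" "\<And>c. c \<in> {1..n} - {a, b} \<Longrightarrow> \<tau> c = \<sigma> c"
    using nab by (auto simp: \<tau>_def)
  have lift: "is_lift (swap_lift p u v) \<tau>"
    using \<tau> by (intro is_lift_swap[OF p \<tau>V V adj]) (auto simp: a_def b_def)
  have dab: "int n dvd p u - int a" "int n dvd p v - int b"
    using ab slot_int slot_eq_iff[OF n_pos] a_def b_def by metis+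
  have "int b - int a - 1 = (p v - p u - 1) - (p v - int b) + (p u - int a)"
    by linarith
  then have "int n dvd int b - int a - 1"
    using dvd_add[OF dvd_diff[OF adj dab(2)] dab(1)] by (rule ssubst)
  then have "(a, b) \<in> parcs (cycle_graph n)"
    using ab cycle_graph_arcs_iff[OF n_ge_3] by blast
  then have "(\<sigma>, \<tau>) \<in> parcs FS"
    using p \<tau>V \<sigma>ab \<tau> uv unfolding arcs_FS_iff is_lift_def by metis
  with lift show ?thesis by blast
qed

lemma winding_swap:
  assumes "is_lift p \<sigma>" "(u, v) \<in> parcs Y" "int n dvd p v - p u - 1"
    and "x \<in> pverts Y" "y \<in> pverts Y" "x \<noteq> y"
  shows "winding n (swap_lift p u v) x y =
    winding n p x y + (if x = u \<and> y = v then 1 else if x = v \<and> y = u then - 1 else 0)"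
  using assms n_ge_3 arc_verts[OF assms(2)] lift_inj[OF assms(1)]
  by (intro winding_swap_lift[where V = "pverts Y"]) auto

text \<open>The two steps cancel in the sum, and the only windings that change belong to friends,
  who are not joined in the complement.\<close>

lemma homotopic_swap:
  assumes "is_lift p \<sigma>" "(u, v) \<in> parcs Y" "int n dvd p v - p u - 1"
  shows "homotopic p (swap_lift p u v)"
proof -
  have uv: "u \<in> pverts Y" "v \<in> pverts Y" "u \<noteq> v" using arc_verts[OF assms(2)] by auto
  have "sum (swap_lift p u v) (pverts Y) =
      (\<Sum>w \<in> pverts Y. p w + ((if w = u then 1 else 0) - (if w = v then 1 else 0)))"
    using uv by (intro sum.cong) (auto simp: swap_lift_def)
  also have "\<dots> = sum p (pverts Y)"
    using uv pair_finite_verts by (simp add: sum.distrib sum_subtractf)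
  finally have "sum (swap_lift p u v) (pverts Y) = sum p (pverts Y)" .
  moreover have "winding n p x y = winding n (swap_lift p u v) x y" if "(x, y) \<in> parcs Yc" for x y
    using that winding_swap[OF assms, of x y] assms(2) arcs_sym by (auto simp: Yc_arcs_iff)
  ultimately show ?thesis by (auto simp: homotopic_def)
qed

text \<open>The walk is lifted arc by arc. Hence a homotopic lift of the target is necessary for
  reachability.\<close>

lemma awalk_lift:
  assumes "FS.awalk \<sigma> e \<tau>" "is_lift p \<sigma>"
  shows "\<exists>q. is_lift q \<tau> \<and> homotopic p q"
  using assms
proof (induction e arbitrary: \<sigma> p)
  case Nil
  then show ?case using homotopic_refl by (auto simp: FS.awalk_Nil_iff)
next
  case (Cons a e)
  obtain \<sigma>' where "a = (\<sigma>, \<sigma>')" "(\<sigma>, \<sigma>') \<in> parcs FS" and e: "FS.awalk \<sigma>' e \<tau>"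
    using Cons.prems(1) by (cases a) (auto simp: FS.awalk_Cons_iff)
  then obtain u v where uv: "(u, v) \<in> parcs Y" "int n dvd p v - p u - 1" "is_lift (swap_lift p u v) \<sigma>'"
    using arc_lift[OF Cons.prems(2)] by blast
  from Cons.IH[OF e uv(3)] show ?case
    using homotopic_swap[OF Cons.prems(2) uv(1,2)] homotopic_trans by blast
qed

section \<open>Sorting one lift into another\<close>

text \<open>Write \<open>p v - p u\<close> as \<open>n * t + 1\<close>. Under \<open>q\<close> this
  gap is smaller, hence at most \<open>n * t\<close>, and equality is excluded because distinct
  people have distinct residues. So the gap has to drop below the multiple
  \<open>n * t\<close>.\<close>

lemma winding_less_if_closer:
  assumes p: "is_lift p \<sigma>" and q: "is_lift q \<tau>" and uv: "u \<in> pverts Y" "v \<in> pverts Y"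
    and adj: "int n dvd p v - p u - 1" and closer: "q v - p v < q u - p u"
  shows "winding n p u v < winding n q u v" "winding n q v u < winding n p v u"
proof -
  define N where "N = int n"
  have N: "N > 1" using n_ge_3 by (simp add: N_def)
  obtain t where t: "p v - p u - 1 = N * t" using adj unfolding N_def by (rule dvdE)
  have "u \<noteq> v" using adj by (rule dvd_succ_neq)
  then have "\<not> N dvd q u - q v"
    using lift_inj[OF q] uv by (auto simp: N_def)
  moreover have "N dvd q u - q v" if "q v - q u = N * t"
    using that by (metis dvd_triv_left dvd_minus_iff minus_diff_eq)
  ultimately have lt: "q v - q u < N * t"
    using closer t by linarith
  have pvu: "winding n p v u = t"
    unfolding winding_def N_def[symmetric] using t N by (intro int_div_pos_eq[of _ _ _ 1]) auto
  have puv: "winding n p u v = - t - 1"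
    unfolding winding_def N_def[symmetric] using t N
    by (intro int_div_pos_eq[of _ _ _ "N - 1"]) (auto simp: algebra_simps)
  have "N * ((q v - q u) div N) \<le> q v - q u"
    using N mult_div_mod_eq[of N "q v - q u"] pos_mod_sign[of N "q v - q u"] by linarith
  then have "N * ((q v - q u) div N) < N * t"
    using lt by linarith
  then show "winding n q v u < winding n p v u"
    using N unfolding pvu by (simp add: winding_def N_def[symmetric])
  have "(- t * N) div N \<le> (q u - q v) div N"
    using lt N by (intro zdiv_mono1) (simp_all add: algebra_simps)
  moreover have "(- t * N) div N = - t"
    using N by (intro nonzero_mult_div_cancel_right) simp
  ultimately show "winding n p u v < winding n q u v"
    unfolding puv by (simp add: winding_def N_def[symmetric])
qed

text \<open>By \<open>no\<close>, displacements never decrease from a person to the next one around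
  the cycle, so they are all equal; as they add up to 0, they vanish.\<close>

lemma lift_eq_if_no_closer:
  assumes p: "is_lift p \<sigma>" and sum: "sum p (pverts Y) = sum q (pverts Y)"
    and no: "\<And>u v. u \<in> pverts Y \<Longrightarrow> v \<in> pverts Y \<Longrightarrow> int n dvd p v - p u - 1 \<Longrightarrow> q u - p u \<le> q v - p v"
    and w: "w \<in> pverts Y"
  shows "q w = p w"
proof -
  define d where "d v = q v - p v" for v
  define M where "M = Max (d ` pverts Y)"
  have ne: "d ` pverts Y \<noteq> {}" "finite (d ` pverts Y)"
    using w pair_finite_verts by auto
  have le: "d v \<le> M" if "v \<in> pverts Y" for v
    using that ne by (auto simp: M_def)
  obtain u where u: "u \<in> pverts Y" "d u = M"
    using Max_in[OF ne(2,1)] by (auto simp: M_def)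
  \<comment> \<open>Going \<open>k\<close> places forward from a person of maximal displacement
    keeps the maximum; this reaches everybody.\<close>
  have step: "d v = M" if "v \<in> pverts Y" "int n dvd p v - p u - int k" for v k
    using that
  proof (induction k arbitrary: v)
    case 0
    then show ?case using lift_inj[OF p, of v u] u by simp
  next
    case (Suc k)
    obtain x where x: "x \<in> pverts Y" "int n dvd p x - (p u + int k)"
      using lift_surj[OF p] by blast
    then have "d x = M" using Suc.IH[of x] by (simp add: algebra_simps)
    moreover have "int n dvd p v - p x - 1"
      using dvd_diff[OF Suc.prems(2) x(2)] by (simp add: algebra_simps)
    ultimately show ?case
      using no[OF x(1) Suc.prems(1)] le[OF Suc.prems(1)] by (simp add: d_def)
  qed
  have "d v = M" if v: "v \<in> pverts Y" for v
  proof -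
    have "p v - p u - (p v - p u) mod int n = int n * ((p v - p u) div int n)"
      by (simp add: minus_mod_eq_mult_div)
    then show ?thesis
      using step[OF v, of "nat ((p v - p u) mod int n)"] n_pos by simp
  qed
  then have "sum d (pverts Y) = int n * M" "d w = M"
    using w by (simp_all add: card_verts)
  moreover have "sum d (pverts Y) = 0"
    using sum by (simp add: d_def sum_subtractf)
  ultimately show ?thesis using n_pos by (simp add: d_def)
qed

text \<open>
  Swapping a neighbouring pair whose order on the universal cover has to be reversed brings both
  of its windings one step closer to their targets, and only those.
\<close>

lemma awalk_exists:
  assumes "is_lift p \<sigma>" "is_lift q \<tau>" "homotopic p q"
  shows "\<exists>e. FS.awalk \<sigma> e \<tau> \<and>
    2 * int (length e) \<le> (\<Sum>(x, y) \<in> parcs Y. \<bar>winding n q x y - winding n p x y\<bar>)"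
  using assms
proof (induction "nat (\<Sum>(x, y) \<in> parcs Y. \<bar>winding n q x y - winding n p x y\<bar>)"
    arbitrary: p \<sigma> rule: less_induct)
  case less
  define D where "D p = (\<Sum>(x, y) \<in> parcs Y. \<bar>winding n q x y - winding n p x y\<bar>)" for p
  show ?case
  proof (cases "\<exists>u v. u \<in> pverts Y \<and> v \<in> pverts Y \<and> int n dvd p v - p u - 1 \<and> q v - p v < q u - p u")
    case True
    then obtain u v where uv: "u \<in> pverts Y" "v \<in> pverts Y" "int n dvd p v - p u - 1"
      "q v - p v < q u - p u" by blast
    note w = winding_less_if_closer[OF less.prems(1,2) uv]
    have ne: "u \<noteq> v" using uv(3) by (rule dvd_succ_neq)
    \<comment> \<open>Homotopy fixes the windings of strangers, so two people whose winding still
      has to change are friends.\<close>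
    have "(u, v) \<notin> parcs Yc" using w less.prems(3) by (auto simp: homotopic_def)
    then have arc: "(u, v) \<in> parcs Y" using uv ne by (auto simp: Yc_arcs_iff)
    define p' where "p' = swap_lift p u v"
    obtain \<sigma>' where \<sigma>': "(\<sigma>, \<sigma>') \<in> parcs FS" "is_lift p' \<sigma>'"
      using lift_arc[OF less.prems(1) arc uv(3)] by (auto simp: p'_def)
    have hom: "homotopic p' q"
      using homotopic_swap[OF less.prems(1) arc uv(3)] less.prems(3) homotopic_sym homotopic_trans
      unfolding p'_def by blast
    have red: "\<bar>winding n q x y - winding n p' x y\<bar> = \<bar>winding n q x y - winding n p x y\<bar>
        - ((if (x, y) = (u, v) then 1 else 0) + (if (x, y) = (v, u) then 1 else 0))"
      if "(x, y) \<in> parcs Y" for x y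
      using winding_swap[OF less.prems(1) arc uv(3), of x y] arc_verts[OF that] w ne
      by (auto simp: p'_def)
    have "D p' = (\<Sum>a \<in> parcs Y. (case a of (x, y) \<Rightarrow> \<bar>winding n q x y - winding n p x y\<bar>)
        - ((if a = (u, v) then 1 else 0) + (if a = (v, u) then 1 else 0)))"
    proof (unfold D_def, rule sum.cong[OF refl])
      fix a assume a: "a \<in> parcs Y"
      obtain x y where xy: "a = (x, y)" by (cases a)
      show "(case a of (x, y) \<Rightarrow> \<bar>winding n q x y - winding n p' x y\<bar>) =
        (case a of (x, y) \<Rightarrow> \<bar>winding n q x y - winding n p x y\<bar>)
          - ((if a = (u, v) then 1 else 0) + (if a = (v, u) then 1 else 0))"
        using red[of x y] a unfolding xy prod.case by blast
    qed
    \<comment> \<open>Both arcs of the friendship contribute one, whence the factor 2 in front of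
      the length.\<close>
    also have "\<dots> = D p - 2"
      using arc arcs_sym[OF arc] pair_finite_arcs
      by (simp add: D_def sum_subtractf sum.distrib)
    finally have D': "D p' = D p - 2" .
    have "0 \<le> D p'" by (auto simp: D_def intro!: sum_nonneg)
    with D' have "nat (D p') < nat (D p)" by linarith
    then obtain e where e: "FS.awalk \<sigma>' e \<tau>" "2 * int (length e) \<le> D p'"
      using less.hyps[OF _ \<sigma>'(2) less.prems(2) hom] unfolding D_def by blast
    have "FS.awalk \<sigma> ((\<sigma>, \<sigma>') # e) \<tau>"
      using e(1) \<sigma>'(1) by (simp add: FS.awalk_Cons_iff)
    moreover have "2 * int (length ((\<sigma>, \<sigma>') # e)) \<le> D p"
      using e(2) D' by simp
    ultimately show ?thesis unfolding D_def by blast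
  next
    case False
    then have "q w = p w" if "w \<in> pverts Y" for w
      using that less.prems(3)
      by (intro lift_eq_if_no_closer[OF less.prems(1)]) (auto simp: homotopic_def not_less)
    then have "is_lift p \<tau>"
      using is_lift_cong[OF less.prems(2), of p] by simp
    then have "\<sigma> = \<tau>" using lift_unique less.prems(1) by blast
    then have "FS.awalk \<sigma> [] \<tau>"
      using less.prems(1) by (simp add: FS.awalk_Nil_iff is_lift_def)
    moreover have "0 \<le> D p" by (auto simp: D_def intro!: sum_nonneg)
    ultimately show ?thesis unfolding D_def by force
  qed
qed

section \<open>Choosing a lift of the target with nearly equal displacements\<close>

text \<open>Each arc of the complement changes the displacement by less than \<open>n\<close>, and a
  path has fewer than \<open>n\<close> arcs.\<close>

lemma displacement_near:
  assumes hom: "homotopic p q" and reach: "x \<rightarrow>\<^sup>*\<^bsub>with_proj Yc\<^esub> y"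
  shows "\<bar>(q x - p x) - (q y - p y)\<bar> \<le> int n * int n"
proof -
  have walk: "\<bar>(q x - p x) - (q y - p y)\<bar> \<le> int n * int (length e)" if "Yc.awalk x e y" for x e
    using that
  proof (induction e arbitrary: x)
    case Nil
    then show ?case by (simp add: Yc.awalk_Nil_iff)
  next
    case (Cons a e)
    obtain z where z: "(x, z) \<in> parcs Yc" "Yc.awalk z e y"
      using Cons.prems by (cases a) (auto simp: Yc.awalk_Cons_iff)
    have "winding n q x z = winding n p x z"
      using hom z(1) by (auto simp: homotopic_def)
    then have "\<bar>(q x - p x) - (q z - p z)\<bar> < int n"
      by (rule displacement_diff_less[OF n_pos])
    then show ?case
      using Cons.IH[OF z(2)] by (simp add: algebra_simps)
  qed
  obtain e where "Yc.apath x e y"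
    using reach Yc.reachable_apath by blast
  then have "Yc.awalk x e y" "length e < n"
    using Yc.length_apath_less[of x e y] by (auto simp: card_verts intro: Yc.awalkI_apath)
  then show ?thesis
    using walk[of x e] mult_left_mono[of "int (length e)" "int n" "int n"] by linarith
qed

text \<open>
  Full turns in opposite directions, \<open>card B\<close> of them for the component \<open>A\<close> of the complement and
  \<open>card A\<close> for the component \<open>B\<close>, lead from a lift to a homotopic one.
\<close>

lemma exists_near_lift:
  assumes q0: "is_lift q0 \<tau>" "homotopic p q0"
  shows "\<exists>q. is_lift q \<tau> \<and> homotopic p q \<and>
    (\<forall>x \<in> pverts Y. \<forall>y \<in> pverts Y. \<bar>(q x - p x) - (q y - p y)\<bar> \<le> int n * (8 * int n))"
proof -
  define N where "N = int n"
  have N: "N \<ge> 1" using n_pos by (simp add: N_def)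
  define \<Phi> where "\<Phi> q = (\<Sum>v \<in> pverts Y. (q v - p v)\<^sup>2)" for q
  obtain q where q: "is_lift q \<tau>" "homotopic p q"
    and min: "\<And>r. is_lift r \<tau> \<Longrightarrow> homotopic p r \<Longrightarrow> nat (\<Phi> q) \<le> nat (\<Phi> r)"
    using ex_has_least_nat[of "\<lambda>q. is_lift q \<tau> \<and> homotopic p q" q0 "\<lambda>q. nat (\<Phi> q)"] q0 by blast
  define d where "d v = q v - p v" for v
  have "d x - d y \<le> 8 * N\<^sup>2" if xy: "x \<in> pverts Y" "y \<in> pverts Y" for x y
  proof (rule ccontr)
    assume "\<not> d x - d y \<le> 8 * N\<^sup>2"
    then have far: "d x - d y > 8 * N\<^sup>2" by simp
    define A where "A = {v. x \<rightarrow>\<^sup>*\<^bsub>with_proj Yc\<^esub> v}"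
    define B where "B = {v. y \<rightarrow>\<^sup>*\<^bsub>with_proj Yc\<^esub> v}"
    have sub: "A \<subseteq> pverts Y" "B \<subseteq> pverts Y"
      using Yc.reachable_in_verts(2) by (auto simp: A_def B_def)
    then have fin: "finite A" "finite B"
      using pair_finite_verts finite_subset by blast+
    have near: "\<bar>d x - d v\<bar> \<le> N\<^sup>2" if "v \<in> A" for v
      using displacement_near[OF q(2)] that by (simp add: A_def d_def N_def power2_eq_square)
    have near': "\<bar>d y - d v\<bar> \<le> N\<^sup>2" if "v \<in> B" for v
      using displacement_near[OF q(2)] that by (simp add: B_def d_def N_def power2_eq_square)
    have disj: "A \<inter> B = {}"
    proof (rule ccontr)
      assume "A \<inter> B \<noteq> {}"
      then obtain v where "v \<in> A" "v \<in> B" by blast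
      then have "d x - d y \<le> 2 * N\<^sup>2" using near[of v] near'[of v] by linarith
      moreover have "0 \<le> N\<^sup>2" by simp
      ultimately show False using far by linarith
    qed
    define a b where "a = int (card A)" and "b = int (card B)"
    have "x \<in> A" "y \<in> B" using xy by (simp_all add: A_def B_def)
    then have ab: "0 < a" "0 < b"
      using fin by (auto simp: a_def b_def card_gt_0_iff)
    have abN: "a \<le> N" "b \<le> N"
      using sub card_mono[OF pair_finite_verts] card_verts by (auto simp: a_def b_def N_def)
    \<comment> \<open>\<open>x\<close> is too far ahead of \<open>y\<close>, so \<open>A\<close>
      turns back and \<open>B\<close> forward; the multiplicities \<open>b\<close> and
      \<open>a\<close> make the sum of \<open>k\<close> vanish.\<close>
    define k where "k v = (if v \<in> B then a else 0) - (if v \<in> A then b else 0)" for v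
    have sumA: "(\<Sum>v \<in> pverts Y. if v \<in> A then c else 0) = a * c" for c :: int
      using sub(1) pair_finite_verts by (simp add: sum.If_cases a_def Int_absorb1)
    have sumB: "(\<Sum>v \<in> pverts Y. if v \<in> B then c else 0) = b * c" for c :: int
      using sub(2) pair_finite_verts by (simp add: sum.If_cases b_def Int_absorb1)
    define r where "r v = q v + N * k v" for v
    have "is_lift r \<tau>"
      by (rule is_lift_cong[OF q(1)]) (simp add: r_def N_def)
    moreover have "homotopic q r"
      unfolding homotopic_def
    proof (intro conjI ballI, safe)
      have "sum k (pverts Y) = 0"
        by (simp add: k_def sum_subtractf sumA sumB)
      then show "sum q (pverts Y) = sum r (pverts Y)"
        by (simp add: r_def sum.distrib flip: sum_distrib_left)
      \<comment> \<open>\<open>k\<close> is constant on components of the complement, so the gap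
        between \<open>u\<close> and \<open>w\<close> does not change at all.\<close>
      fix u w assume uw: "(u, w) \<in> parcs Yc"
      then have wu: "(w, u) \<in> parcs Yc" using arcs_sym by (auto simp: Yc_arcs_iff)
      have "z \<rightarrow>\<^sup>*\<^bsub>with_proj Yc\<^esub> u \<longleftrightarrow> z \<rightarrow>\<^sup>*\<^bsub>with_proj Yc\<^esub> w" for z
        using Yc.reachable_adj_trans[OF _ uw] Yc.reachable_adj_trans[OF _ wu] by (rule iffI)
      then have "u \<in> A \<longleftrightarrow> w \<in> A" "u \<in> B \<longleftrightarrow> w \<in> B"
        unfolding A_def B_def mem_Collect_eq by this+
      then have "k u = k w" by (simp add: k_def)
      then show "winding n q u w = winding n r u w" by (simp add: winding_def r_def)
    qed
    then have "homotopic p r" using q(2) homotopic_trans by blast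
    ultimately have "nat (\<Phi> q) \<le> nat (\<Phi> r)" by (rule min)
    moreover have "0 \<le> \<Phi> q" "0 \<le> \<Phi> r" by (simp_all add: \<Phi>_def sum_nonneg)
    ultimately have le: "\<Phi> q \<le> \<Phi> r" by simp
    \<comment> \<open>\<open>M\<close> bounds the displacements in \<open>A\<close> from below.
      Those in \<open>B\<close> are at most \<open>d y + N\<^sup>2\<close>, hence at most
      \<open>M - 6 * N\<^sup>2\<close> by \<open>far\<close>. \<open>cA\<close> and
      \<open>cB\<close> then bound the change of the square for each member of \<open>A\<close> and
      of \<open>B\<close>.\<close>
    define M where "M = d x - N\<^sup>2"
    define cA where "cA = N\<^sup>2 * b\<^sup>2 - 2 * N * b * M"
    define cB where "cB = N\<^sup>2 * a\<^sup>2 + 2 * N * a * (M - 6 * N\<^sup>2)"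
    have "(r v - p v)\<^sup>2 - (q v - p v)\<^sup>2 \<le> (if v \<in> A then cA else 0) + (if v \<in> B then cB else 0)" for v
    proof -
      have eq: "(r v - p v)\<^sup>2 - (q v - p v)\<^sup>2 = N\<^sup>2 * (k v)\<^sup>2 + 2 * N * k v * d v"
        by (simp add: r_def d_def power2_eq_square algebra_simps)
      consider "v \<in> A" "v \<notin> B" | "v \<in> B" "v \<notin> A" | "v \<notin> A" "v \<notin> B" using disj by blast
      then show ?thesis
      proof cases
        case 1
        have "M \<le> d v" using near[OF 1(1)] by (simp add: M_def)
        then have "2 * N * b * M \<le> 2 * N * b * d v"
          using N ab by (intro mult_left_mono) auto
        then show ?thesis using 1 by (simp add: eq k_def cA_def)
      next
        case 2
        have "d v \<le> M - 6 * N\<^sup>2" using near'[OF 2(1)] far by (simp add: M_def)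
        then have "2 * N * a * d v \<le> 2 * N * a * (M - 6 * N\<^sup>2)"
          using N ab by (intro mult_left_mono) auto
        then show ?thesis using 2 by (simp add: eq k_def cB_def)
      next
        case 3
        then show ?thesis by (simp add: eq k_def)
      qed
    qed
    then have "\<Phi> r - \<Phi> q \<le> (\<Sum>v \<in> pverts Y. (if v \<in> A then cA else 0) + (if v \<in> B then cB else 0))"
      unfolding \<Phi>_def sum_subtractf[symmetric] by (intro sum_mono)
    also have "\<dots> = a * cA + b * cB"
      by (simp only: sum.distrib sumA sumB)
    \<comment> \<open>The terms in \<open>M\<close> cancel, as \<open>a\<close> members turn
      \<open>b\<close> times and \<open>b\<close> members turn \<open>a\<close> times the other
      way.\<close>
    also have "\<dots> = (N\<^sup>2 * a * b) * (a + b - 12 * N)"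
      by (simp add: cA_def cB_def power2_eq_square algebra_simps)
    \<comment> \<open>\<open>a + b\<close> is at most \<open>2 * N\<close>, so the turns would
      decrease the minimal \<open>\<Phi> q\<close>.\<close>
    also have "\<dots> < 0"
      using N ab abN by (intro mult_pos_neg) auto
    finally show False using le by simp
  qed
  then have "\<bar>d x - d y\<bar> \<le> N * (8 * N)" if "x \<in> pverts Y" "y \<in> pverts Y" for x y
    using that by (auto simp: abs_le_iff power2_eq_square algebra_simps)
  then show ?thesis
    using q unfolding d_def N_def by blast
qed

section \<open>Short walks and the diameter\<close>

text \<open>The given walk provides a homotopic lift of \<open>\<tau>\<close>, which is replaced by
  a near one. At most \<open>n * n\<close> arcs then have windings that change by at most
  \<open>8 * n\<close> each, and this total is at least twice the length of a new walk.\<close>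

lemma short_awalk_exists:
  assumes "FS.awalk \<sigma> e0 \<tau>"
  shows "\<exists>e. FS.awalk \<sigma> e \<tau> \<and> length e \<le> 4 * n ^ 3"
proof -
  have "\<sigma> \<in> pverts FS" using FS.awalk_hd_in_verts[OF assms] by simp
  then obtain p where p: "is_lift p \<sigma>" using lift_exists by blast
  obtain q where q: "is_lift q \<tau>" "homotopic p q"
    "\<forall>x \<in> pverts Y. \<forall>y \<in> pverts Y. \<bar>(q x - p x) - (q y - p y)\<bar> \<le> int n * (8 * int n)"
    using awalk_lift[OF assms p] exists_near_lift by blast
  obtain e where e: "FS.awalk \<sigma> e \<tau>"
    "2 * int (length e) \<le> (\<Sum>(x, y) \<in> parcs Y. \<bar>winding n q x y - winding n p x y\<bar>)"
    using awalk_exists[OF p q(1,2)] by blast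
  have "parcs Y \<subseteq> pverts Y \<times> pverts Y"
    using arc_verts by (intro subrelI) simp
  then have card: "card (parcs Y) \<le> n * n"
    using card_mono[of "pverts Y \<times> pverts Y" "parcs Y"] pair_finite_verts
    by (simp add: card_cartesian_product card_verts)
  have "\<bar>winding n q x y - winding n p x y\<bar> \<le> 8 * int n" if "(x, y) \<in> parcs Y" for x y
    using q(3) arc_verts[OF that] by (intro winding_diff_bound n_pos) blast
  then have "(\<Sum>(x, y) \<in> parcs Y. \<bar>winding n q x y - winding n p x y\<bar>) \<le> int (card (parcs Y)) * (8 * int n)"
    by (intro sum_bounded_above) (simp only: split_paired_all prod.case)
  also have "\<dots> \<le> int (n * n) * (8 * int n)"
    using card by (intro mult_right_mono) (simp_all del: of_nat_mult)
  finally have "2 * int (length e) \<le> int (8 * n ^ 3)"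
    using e(2) by (simp add: power3_eq_cube)
  then have "2 * length e \<le> 8 * n ^ 3" by linarith
  with e(1) show ?thesis by (intro exI[of _ e]) simp
qed

text \<open>Distances are taken inside \<open>H\<close>, so the short walk is first recognised as a
  walk of \<open>H\<close>; with unit weights its cost is its length.\<close>

lemma graph_diameter_scc_le:
  assumes H: "H \<in> FS.sccs"
  shows "graph_diameter H \<le> ereal (real (4 * n ^ 3))"
  unfolding graph_diameter_def
proof (intro SUP_least)
  fix \<sigma> \<tau> assume st: "\<sigma> \<in> verts H" "\<tau> \<in> verts H"
  have "subgraph H (with_proj FS)"
    using FS.in_sccs_imp_induced[OF H] by (simp add: induced_subgraph_def)
  then interpret H: wf_digraph H by (rule subgraphE)
  have "verts H \<in> FS.sccs_verts"
    using H by (intro FS.in_sccs_vertsI_sccs imageI)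
  then have "\<sigma> \<rightarrow>\<^sup>*\<^bsub>with_proj FS\<^esub> \<tau>"
    using st unfolding FS.in_sccs_verts_conv_reachable by blast
  then obtain e where e: "FS.awalk \<sigma> e \<tau>" "length e \<le> 4 * n ^ 3"
    using short_awalk_exists by (metis FS.reachable_awalk)
  have "H.\<mu> (\<lambda>_. 1) \<sigma> \<tau> \<le> ereal (H.awalk_cost (\<lambda>_. 1) e)"
    using FS.awalk_in_scc[OF H e(1) st(1)] by (rule H.min_cost_le_walk_cost)
  also have "H.awalk_cost (\<lambda>_. 1) e = real (length e)"
    by (induction e) simp_all
  also have "ereal (real (length e)) \<le> ereal (real (4 * n ^ 3))"
    using e(2) by (simp only: ereal_less_eq of_nat_le_iff)
  finally show "H.\<mu> (\<lambda>_. 1) \<sigma> \<tau> \<le> ereal (real (4 * n ^ 3))" .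
qed

end

theorem theorem3p7:
  fixes Y :: "'a pair_pre_digraph" and n :: nat
  assumes "pair_graph Y"
    and "card (pverts Y) = n"
    and "n \<ge> 3"
    and "(GCD C \<in> pre_digraph.sccs (with_proj (complement_graph Y)). card (verts C)) = 1"
  shows "\<forall>H \<in> pre_digraph.sccs (with_proj (FS_graph (cycle_graph n) Y)).
           graph_diameter H \<le> ereal (real (4 * n ^ 3 + card (uedges Y)))"
proof
  interpret cycle_FS Y n
    using assms by (simp add: cycle_FS_def cycle_FS_axioms_def)
  fix H assume "H \<in> pre_digraph.sccs (with_proj (FS_graph (cycle_graph n) Y))"
  then have "graph_diameter H \<le> ereal (real (4 * n ^ 3))"
    by (rule graph_diameter_scc_le)
  also have "\<dots> \<le> ereal (real (4 * n ^ 3 + card (uedges Y)))"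
    by simp
  finally show "graph_diameter H \<le> ereal (real (4 * n ^ 3 + card (uedges Y)))" .
qed

end
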